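(* Let $G$ be a reductive group over an algebraically closed field, and let $H$ be a subgroup of (the abstract group) $G$ that is Zariski-dense in $G$. Then any virtually trivial split $BN$-pair of $H$ is trivial. That is, if $(B,N)$ is a split $BN$-pair of $H$ with $[H:B]<\infty$, then $B=H$.
   Context: Reductive groups are connected by definition; algebraic groups over an algebraically closed field are linear algebraic groups, identified with their groups of points. A $BN$-pair of a group $H$ is a pair of subgroups $(B,N)$ generating $H$ such that $T:=B\cap N$ is normal in $N$ and $W:=N/T$ admits a generating set $S$ with, for all $s\in S$, $w\in W$: (BN1) $sBw\subseteq BswB\cup BwB$, and (BN2) $sBs^{-1}\not\leq B$. (Then $(W,S)$ is a Coxeter system, called the type of the $BN$-pair.) The $BN$-pair is saturated if $B\cap N=\bigcap_{w\in W}wBw^{-1}$. It is split if it is saturated and $B=U\rtimes T$ for some nilpotent subgroup $U$ (normal in $B$). It is trivial if $B=H$, and virtually trivial if $[H:B]<\infty$. *)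

theory Defs
  imports
    "HOL-Analysis.Analysis"
    "HOL-Algebra.Coset"
    "HOL-Algebra.Generated_Groups"
    "HOL-Computational_Algebra.Polynomial"
begin

section \<open>Linear algebraic groups\<close>

text \<open>
  A linear algebraic group over an algebraically closed field \<open>'a\<close> is a Zariski-closed
  subgroup of some \<open>GL\<^sub>n('a)\<close>; the size \<open>n\<close> is the cardinality of the index type \<open>'n\<close>.
  Matrix product and identity are \<open>(**)\<close> and \<open>mat 1\<close>; the type-class operations
  \<open>*\<close>, \<open>1\<close> and \<open>^\<close> on \<open>'a ^ 'n ^ 'n\<close> are componentwise and are not used.
\<close>

definition GL :: "('a::field ^ 'n ^ 'n) monoid" where
  "GL = \<lparr>carrier = {g. invertible g}, mult = (**), one = mat 1\<rparr>"

text \<open>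
  The coordinate ring of \<open>GL\<^sub>n\<close>, generated over the constants by the matrix entries and
  \<open>1/det\<close>. Only the values at invertible matrices matter.
\<close>

inductive_set regular_functions :: "('a::field ^ 'n ^ 'n \<Rightarrow> 'a) set" where
  const: "(\<lambda>g. c) \<in> regular_functions"
| entry: "(\<lambda>g. g $ i $ j) \<in> regular_functions"
| inverse_det: "(\<lambda>g. inverse (det g)) \<in> regular_functions"
| add: "p \<in> regular_functions \<Longrightarrow> q \<in> regular_functions \<Longrightarrow> (\<lambda>g. p g + q g) \<in> regular_functions"
| mult: "p \<in> regular_functions \<Longrightarrow> q \<in> regular_functions \<Longrightarrow> (\<lambda>g. p g * q g) \<in> regular_functions"

definition zariski_open :: "('a::field ^ 'n ^ 'n) set \<Rightarrow> bool" where
  "zariski_open U \<longleftrightarrow>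
     (\<exists>F \<subseteq> regular_functions. U = {g \<in> carrier GL. \<exists>p\<in>F. p g \<noteq> 0})"

definition zariski :: "('a::field ^ 'n ^ 'n) topology" where
  "zariski = topology zariski_open"

lemma istopology_zariski_open: "istopology zariski_open"
proof -
  have "zariski_open (S \<inter> T)"
    if S: "zariski_open S" and T: "zariski_open T" for S T :: "('a::field ^ 'n ^ 'n) set"
  proof -
    obtain F where F: "F \<subseteq> regular_functions" "S = {g \<in> carrier GL. \<exists>p\<in>F. p g \<noteq> 0}"
      using S unfolding zariski_open_def by blast
    obtain F' where F': "F' \<subseteq> regular_functions" "T = {g \<in> carrier GL. \<exists>p\<in>F'. p g \<noteq> 0}"
      using T unfolding zariski_open_def by blast
    let ?P = "(\<lambda>(p, q) g. p g * q g) ` (F \<times> F')"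
    have "?P \<subseteq> regular_functions"
      using F(1) F'(1) by (auto intro!: regular_functions.mult)
    moreover have "S \<inter> T = {g \<in> carrier GL. \<exists>r\<in>?P. r g \<noteq> 0}"
    proof (intro Set.set_eqI iffI)
      fix g assume "g \<in> S \<inter> T"
      then obtain p q where "g \<in> carrier GL" "p \<in> F" "q \<in> F'" "p g * q g \<noteq> 0"
        unfolding F(2) F'(2) by auto
      then show "g \<in> {g \<in> carrier GL. \<exists>r\<in>?P. r g \<noteq> 0}"
        by (auto intro!: bexI[of _ "(p, q)"])
    next
      fix g assume "g \<in> {g \<in> carrier GL. \<exists>r\<in>?P. r g \<noteq> 0}"
      then obtain p q where "g \<in> carrier GL" "p \<in> F" "q \<in> F'" "p g * q g \<noteq> 0"
        by auto
      then show "g \<in> S \<inter> T"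
        unfolding F(2) F'(2) by auto
    qed
    ultimately show ?thesis
      unfolding zariski_open_def by (intro exI[of _ ?P] conjI)
  qed
  moreover have "zariski_open (\<Union>\<K>)"
    if K: "\<forall>K\<in>\<K>. zariski_open K" for \<K> :: "('a::field ^ 'n ^ 'n) set set"
  proof -
    let ?F = "{p \<in> regular_functions. \<forall>g\<in>carrier GL. p g \<noteq> 0 \<longrightarrow> g \<in> \<Union>\<K>}"
    have "\<Union>\<K> = {g \<in> carrier GL. \<exists>p\<in>?F. p g \<noteq> 0}"
    proof (intro subset_antisym subsetI)
      fix g assume "g \<in> \<Union>\<K>"
      then obtain U where U: "U \<in> \<K>" "g \<in> U" by blast
      then have "zariski_open U" using K by blast
      then obtain F where F: "F \<subseteq> regular_functions" "U = {g \<in> carrier GL. \<exists>p\<in>F. p g \<noteq> 0}"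
        unfolding zariski_open_def by blast
      then obtain p where p: "g \<in> carrier GL" "p \<in> F" "p g \<noteq> 0"
        using U(2) by auto
      have "p \<in> ?F"
      proof (intro CollectI conjI ballI impI)
        show "p \<in> regular_functions"
          using F(1) p(2) by (rule subsetD)
        fix h :: "'a ^ 'n ^ 'n" assume "h \<in> carrier GL" "p h \<noteq> 0"
        then have "h \<in> U"
          using p(2) unfolding F(2) by auto
        then show "h \<in> \<Union>\<K>"
          using U(1) by (rule UnionI[rotated])
      qed
      with p show "g \<in> {g \<in> carrier GL. \<exists>p\<in>?F. p g \<noteq> 0}"
        by auto
    qed auto
    moreover have "?F \<subseteq> regular_functions"
      by auto
    ultimately show ?thesis
      unfolding zariski_open_def by (intro exI[of _ ?F] conjI)
  qed
  ultimately show ?thesis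
    unfolding istopology_def by blast
qed

lemma openin_zariski: "openin zariski U \<longleftrightarrow> zariski_open U"
  unfolding zariski_def by (simp add: istopology_zariski_open)

lemma topspace_zariski: "topspace zariski = carrier GL"
proof
  show "topspace zariski \<subseteq> carrier GL"
    using openin_topspace[of zariski] unfolding openin_zariski zariski_open_def by auto
  have "zariski_open (carrier GL :: ('a ^ 'n ^ 'n) set)"
    unfolding zariski_open_def
    by (rule exI[of _ "{\<lambda>g. 1}"]) (auto intro: regular_functions.const)
  then show "carrier GL \<subseteq> topspace (zariski :: ('a ^ 'n ^ 'n) topology)"
    using openin_zariski openin_subset by blast
qed

lemma closedin_zariski:
  fixes V :: "('a::field ^ 'n ^ 'n) set"
  shows "closedin zariski V \<longleftrightarrow>
     (\<exists>F \<subseteq> regular_functions. V = {g \<in> carrier GL. \<forall>p\<in>F. p g = 0})"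
proof -
  have eq: "V \<subseteq> carrier GL \<and> carrier GL - V = {g \<in> carrier GL. \<exists>p\<in>F. p g \<noteq> 0} \<longleftrightarrow>
      V = {g \<in> carrier GL. \<forall>p\<in>F. p g = 0}" for F :: "('a ^ 'n ^ 'n \<Rightarrow> 'a) set"
    by blast
  have pull: "A \<and> (\<exists>F. R F \<and> P F) \<longleftrightarrow> (\<exists>F. R F \<and> A \<and> P F)"
    for A and R P :: "('a ^ 'n ^ 'n \<Rightarrow> 'a) set \<Rightarrow> bool"
    by blast
  show ?thesis
    unfolding closedin_def openin_zariski topspace_zariski zariski_open_def pull eq ..
qed

definition algebraic_group :: "('a::field ^ 'n ^ 'n) set \<Rightarrow> bool" where
  "algebraic_group G \<longleftrightarrow> subgroup G GL \<and> closedin zariski G"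

definition unipotent :: "'a::field ^ 'n ^ 'n \<Rightarrow> bool" where
  "unipotent g \<longleftrightarrow> (\<exists>k. (((**) (g - mat 1)) ^^ k) (mat 1) = 0)"

text \<open>
  The largest closed connected normal unipotent subgroup, given as the subgroup generated
  by all of them.
\<close>

definition unipotent_radical :: "('a::field ^ 'n ^ 'n) set \<Rightarrow> ('a ^ 'n ^ 'n) set" where
  "unipotent_radical G = generate (GL\<lparr>carrier := G\<rparr>)
     (\<Union>{V. V \<lhd> GL\<lparr>carrier := G\<rparr> \<and> closedin zariski V \<and> connectedin zariski V \<and>
           (\<forall>g\<in>V. unipotent g)})"

definition reductive_group :: "('a::alg_closed_field ^ 'n ^ 'n) set \<Rightarrow> bool" where
  "reductive_group G \<longleftrightarrow>
     algebraic_group G \<and> connectedin zariski G \<and> unipotent_radical G = {mat 1}"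

section \<open>Nilpotent groups and split BN-pairs\<close>

primrec lower_central :: "('g, 'b) monoid_scheme \<Rightarrow> nat \<Rightarrow> 'g set" where
  "lower_central G 0 = carrier G"
| "lower_central G (Suc n) = generate G
     (\<Union>x\<in>carrier G. \<Union>y\<in>lower_central G n. {x \<otimes>\<^bsub>G\<^esub> y \<otimes>\<^bsub>G\<^esub> inv\<^bsub>G\<^esub> x \<otimes>\<^bsub>G\<^esub> inv\<^bsub>G\<^esub> y})"

definition nilpotent_group :: "('g, 'b) monoid_scheme \<Rightarrow> bool" where
  "nilpotent_group G \<longleftrightarrow> group G \<and> (\<exists>n. lower_central G n = {\<one>\<^bsub>G\<^esub>})"

text \<open>
  Elements of \<open>W = N/T\<close> are cosets of \<open>T = B \<inter> N\<close>, hence subsets of \<open>H\<close>, and expressions such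
  as \<open>sBw\<close> are set products in \<open>H\<close>. Since \<open>T \<subseteq> B\<close> is normal in \<open>N\<close>, this gives the same
  subsets as choosing representatives of \<open>s\<close> and \<open>w\<close> in \<open>N\<close>.
\<close>

definition weyl_group :: "('g, 'b) monoid_scheme \<Rightarrow> 'g set \<Rightarrow> 'g set \<Rightarrow> 'g set monoid" where
  "weyl_group H B N = (H\<lparr>carrier := N\<rparr>) Mod (B \<inter> N)"

definition BN_pair :: "('g, 'b) monoid_scheme \<Rightarrow> 'g set \<Rightarrow> 'g set \<Rightarrow> bool" where
  "BN_pair H B N \<longleftrightarrow>
     group H \<and> subgroup B H \<and> subgroup N H \<and> generate H (B \<union> N) = carrier H \<and>
     (B \<inter> N) \<lhd> H\<lparr>carrier := N\<rparr> \<and>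
     (let W = weyl_group H B N in
       \<exists>S \<subseteq> carrier W. generate W S = carrier W \<and>
         (\<forall>s\<in>S. \<forall>w\<in>carrier W.
            s <#>\<^bsub>H\<^esub> B <#>\<^bsub>H\<^esub> w \<subseteq>
              (B <#>\<^bsub>H\<^esub> (s \<otimes>\<^bsub>W\<^esub> w) <#>\<^bsub>H\<^esub> B) \<union> (B <#>\<^bsub>H\<^esub> w <#>\<^bsub>H\<^esub> B)) \<and>
         (\<forall>s\<in>S. \<not> s <#>\<^bsub>H\<^esub> B <#>\<^bsub>H\<^esub> inv\<^bsub>W\<^esub> s \<subseteq> B))"

definition saturated_BN_pair :: "('g, 'b) monoid_scheme \<Rightarrow> 'g set \<Rightarrow> 'g set \<Rightarrow> bool" where
  "saturated_BN_pair H B N \<longleftrightarrow>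
     BN_pair H B N \<and>
     (let W = weyl_group H B N in
       B \<inter> N = (\<Inter>w\<in>carrier W. w <#>\<^bsub>H\<^esub> B <#>\<^bsub>H\<^esub> inv\<^bsub>W\<^esub> w))"

definition split_BN_pair :: "('g, 'b) monoid_scheme \<Rightarrow> 'g set \<Rightarrow> 'g set \<Rightarrow> bool" where
  "split_BN_pair H B N \<longleftrightarrow>
     saturated_BN_pair H B N \<and>
     (\<exists>U. U \<lhd> H\<lparr>carrier := B\<rparr> \<and> nilpotent_group (H\<lparr>carrier := U\<rparr>) \<and>
          U <#>\<^bsub>H\<^esub> (B \<inter> N) = B \<and> U \<inter> (B \<inter> N) = {\<one>\<^bsub>H\<^esub>})"

definition trivial_BN_pair :: "('g, 'b) monoid_scheme \<Rightarrow> 'g set \<Rightarrow> 'g set \<Rightarrow> bool" where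
  "trivial_BN_pair H B N \<longleftrightarrow> BN_pair H B N \<and> B = carrier H"

definition virtually_trivial_BN_pair :: "('g, 'b) monoid_scheme \<Rightarrow> 'g set \<Rightarrow> 'g set \<Rightarrow> bool" where
  "virtually_trivial_BN_pair H B N \<longleftrightarrow> BN_pair H B N \<and> finite (rcosets\<^bsub>H\<^esub> B)"

end

theory Submission
  imports Defs
begin

text \<open>
  Write \<open>B = UT\<close> with \<open>T = B \<inter> N\<close>. By saturation \<open>T\<close> contains every element acting trivially on
  the finite set of cosets of \<open>B\<close>; as \<open>U\<close> meets \<open>T\<close> trivially, \<open>U\<close> acts faithfully there and is
  finite. As \<open>U\<close> is normal in the finite-index subgroup \<open>B\<close>, each \<open>u \<in> U\<close> has a finite conjugacy
  class under the dense subgroup \<open>H\<close>, hence under \<open>G\<close>, and is therefore central because \<open>G\<close> is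
  connected. So \<open>N\<close> centralises \<open>U\<close> and normalises \<open>T\<close>, hence normalises \<open>B\<close>; by (BN2)
  there are no simple reflections, and \<open>B = H\<close>.
\<close>

section \<open>Elements of \<open>weyl_group\<close> as cosets inside \<open>N\<close>\<close>

lemma carrier_weyl_groupE:
  assumes "s \<in> carrier (weyl_group H B N)"
  obtains n where "n \<in> N" "s = (B \<inter> N) #>\<^bsub>H\<^esub> n"
  using assms
  by (auto simp: weyl_group_def FactGroup_def RCOSETS_def r_coset_def)

lemma r_coset_in_carrier_weyl_group:
  "n \<in> N \<Longrightarrow> (B \<inter> N) #>\<^bsub>H\<^esub> n \<in> carrier (weyl_group H B N)"
  by (auto simp: weyl_group_def FactGroup_def RCOSETS_def r_coset_def)

lemma weyl_group_mult [simp]: "s \<otimes>\<^bsub>weyl_group H B N\<^esub> t = s <#>\<^bsub>H\<^esub> t"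
  by (simp add: weyl_group_def FactGroup_def set_mult_def)

lemma weyl_group_one [simp]: "\<one>\<^bsub>weyl_group H B N\<^esub> = B \<inter> N"
  by (simp add: weyl_group_def FactGroup_def)

lemma BN_pair_group_weyl_group: "BN_pair H B N \<Longrightarrow> group (weyl_group H B N)"
  unfolding BN_pair_def weyl_group_def by (blast intro: normal.factorgroup_is_group)

lemma BN_pair_weyl_group_subset:
  assumes "BN_pair H B N" "s \<in> carrier (weyl_group H B N)"
  shows "s \<subseteq> N"
proof -
  have N: "subgroup N H"
    using assms(1) by (simp add: BN_pair_def)
  obtain n where "n \<in> N" "s = (B \<inter> N) #>\<^bsub>H\<^esub> n"
    using carrier_weyl_groupE[OF assms(2)] .
  then show ?thesis
    using subgroup.m_closed[OF N] by (auto simp: r_coset_def)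
qed

section \<open>Consequences of saturation and finite index\<close>

lemma saturated_BN_pair_memI:
  assumes sat: "saturated_BN_pair H B N" and x: "x \<in> carrier H"
    and conj: "\<And>h. h \<in> carrier H \<Longrightarrow> h \<otimes>\<^bsub>H\<^esub> x \<otimes>\<^bsub>H\<^esub> inv\<^bsub>H\<^esub> h \<in> B"
  shows "x \<in> B \<inter> N"
proof -
  let ?W = "weyl_group H B N"
  have bn: "BN_pair H B N"
    using sat by (simp add: saturated_BN_pair_def)
  then interpret group H by (simp add: BN_pair_def)
  interpret W: group ?W using bn by (rule BN_pair_group_weyl_group)
  have N: "subgroup N H" using bn by (simp add: BN_pair_def)
  have one: "\<one>\<^bsub>H\<^esub> \<in> B \<inter> N"
    using bn by (auto simp: BN_pair_def subgroup.one_closed)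
  \<comment> \<open>The product of \<open>w\<close> with its inverse is the coset
    \<open>B \<inter> N\<close>, which contains the identity. This yields mutually inverse
    representatives \<open>a\<close> of \<open>w\<close> and \<open>b\<close> of its inverse. Then
    \<open>b x a\<close> is a conjugate of \<open>x\<close>, hence in \<open>B\<close>, and
    \<open>x = a (b x a) b\<close>.\<close>
  have "x \<in> w <#>\<^bsub>H\<^esub> B <#>\<^bsub>H\<^esub> inv\<^bsub>?W\<^esub> w" if w: "w \<in> carrier ?W" for w
  proof -
    have "\<one>\<^bsub>H\<^esub> \<in> w <#>\<^bsub>H\<^esub> inv\<^bsub>?W\<^esub> w"
      using W.r_inv[OF w] one by simp
    then obtain a b where ab: "a \<in> w" "b \<in> inv\<^bsub>?W\<^esub> w" "\<one>\<^bsub>H\<^esub> = a \<otimes>\<^bsub>H\<^esub> b"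
      by (auto simp: set_mult_def)
    have "a \<in> N" "b \<in> N"
      using ab w W.inv_closed[OF w] BN_pair_weyl_group_subset[OF bn] by blast+
    then have car: "a \<in> carrier H" "b \<in> carrier H"
      using subgroup.mem_carrier[OF N] by auto
    then have "inv\<^bsub>H\<^esub> b = a" "inv\<^bsub>H\<^esub> a = b"
      using ab(3) inv_equality[of a b] inv_inv by auto
    then have "b \<otimes>\<^bsub>H\<^esub> x \<otimes>\<^bsub>H\<^esub> a \<in> B"
      using conj[OF car(2)] by simp
    moreover have "a \<otimes>\<^bsub>H\<^esub> (b \<otimes>\<^bsub>H\<^esub> x \<otimes>\<^bsub>H\<^esub> a) \<otimes>\<^bsub>H\<^esub> b
        = (a \<otimes>\<^bsub>H\<^esub> b) \<otimes>\<^bsub>H\<^esub> x \<otimes>\<^bsub>H\<^esub> (a \<otimes>\<^bsub>H\<^esub> b)"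
      using car x by (simp add: m_assoc)
    then have "x = a \<otimes>\<^bsub>H\<^esub> (b \<otimes>\<^bsub>H\<^esub> x \<otimes>\<^bsub>H\<^esub> a) \<otimes>\<^bsub>H\<^esub> b"
      using x by (simp add: ab(3)[symmetric])
    ultimately show ?thesis
      using ab(1,2) unfolding set_mult_def by blast
  qed
  then show ?thesis
    using sat unfolding saturated_BN_pair_def Let_def by blast
qed

text \<open>Right multiplication embeds \<open>U\<close> into the finite set of self-maps of the
  coset space: the kernel lies in \<open>B \<inter> N\<close>, which meets \<open>U\<close> only in
  the identity.\<close>

lemma saturated_BN_pair_finite_complement:
  assumes sat: "saturated_BN_pair H B N" and fin: "finite (rcosets\<^bsub>H\<^esub> B)"
    and U: "subgroup U H" and triv: "U \<inter> (B \<inter> N) = {\<one>\<^bsub>H\<^esub>}"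
  shows "finite U"
proof -
  have bn: "BN_pair H B N"
    using sat by (simp add: saturated_BN_pair_def)
  then interpret group H by (simp add: BN_pair_def)
  have B: "subgroup B H" using bn by (simp add: BN_pair_def)
  have Bc: "B \<subseteq> carrier H" using B by (rule subgroup.subset)
  have Uc: "\<And>u. u \<in> U \<Longrightarrow> u \<in> carrier H"
    using subgroup.mem_carrier[OF U] .
  \<comment> \<open>Restricting to the cosets makes the maps extensional, so that they lie in a
    function space that is finite along with the coset space.\<close>
  let ?act = "\<lambda>u. \<lambda>c \<in> rcosets\<^bsub>H\<^esub> B. c #>\<^bsub>H\<^esub> u"
  have "inj_on ?act U"
  proof (rule inj_onI)
    fix u v assume u: "u \<in> U" and v: "v \<in> U" and eq: "?act u = ?act v"
    \<comment> \<open>Equality of the two actions at the coset \<open>B h\<close> says exactly that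
      the conjugate of \<open>u v^-1\<close> by \<open>h\<close> lies in \<open>B\<close>; here
      \<open>h\<close> is arbitrary.\<close>
    have "u \<otimes>\<^bsub>H\<^esub> inv\<^bsub>H\<^esub> v \<in> B \<inter> N"
    proof (rule saturated_BN_pair_memI[OF sat])
      show "u \<otimes>\<^bsub>H\<^esub> inv\<^bsub>H\<^esub> v \<in> carrier H" using Uc[OF u] Uc[OF v] by simp
      fix h assume h: "h \<in> carrier H"
      have "B #>\<^bsub>H\<^esub> h \<in> rcosets\<^bsub>H\<^esub> B" using h Bc by (auto simp: rcosetsI)
      then have "B #>\<^bsub>H\<^esub> h #>\<^bsub>H\<^esub> u = B #>\<^bsub>H\<^esub> h #>\<^bsub>H\<^esub> v"
        using fun_cong[OF eq, of "B #>\<^bsub>H\<^esub> h"] by simp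
      then have "B #>\<^bsub>H\<^esub> (h \<otimes>\<^bsub>H\<^esub> u) = B #>\<^bsub>H\<^esub> (h \<otimes>\<^bsub>H\<^esub> v)"
        using coset_mult_assoc[OF Bc h] Uc u v by simp
      then have "h \<otimes>\<^bsub>H\<^esub> u \<in> B #>\<^bsub>H\<^esub> (h \<otimes>\<^bsub>H\<^esub> v)"
        using rcos_self[OF _ B, of "h \<otimes>\<^bsub>H\<^esub> u"] h Uc[OF u] by simp
      then have "h \<otimes>\<^bsub>H\<^esub> u \<otimes>\<^bsub>H\<^esub> inv\<^bsub>H\<^esub> (h \<otimes>\<^bsub>H\<^esub> v) \<in> B"
        using subgroup.rcos_module_imp[OF B group_axioms] h Uc[OF v] by simp
      then show "h \<otimes>\<^bsub>H\<^esub> (u \<otimes>\<^bsub>H\<^esub> inv\<^bsub>H\<^esub> v) \<otimes>\<^bsub>H\<^esub> inv\<^bsub>H\<^esub> h \<in> B"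
        using h Uc[OF u] Uc[OF v] by (simp add: inv_mult_group m_assoc)
    qed
    moreover have "u \<otimes>\<^bsub>H\<^esub> inv\<^bsub>H\<^esub> v \<in> U"
      using U u v by (simp add: subgroup.m_closed subgroup.m_inv_closed)
    ultimately have "u \<otimes>\<^bsub>H\<^esub> inv\<^bsub>H\<^esub> v = \<one>\<^bsub>H\<^esub>" using triv by blast
    then show "u = v"
      using Uc[OF u] Uc[OF v] by (metis inv_closed inv_equality inv_inv)
  qed
  moreover have "?act ` U \<subseteq> rcosets\<^bsub>H\<^esub> B \<rightarrow>\<^sub>E rcosets\<^bsub>H\<^esub> B"
  proof (safe intro!: restrict_PiE_iff[THEN iffD2])
    fix u c assume "u \<in> U" "c \<in> rcosets\<^bsub>H\<^esub> B"
    then show "c #>\<^bsub>H\<^esub> u \<in> rcosets\<^bsub>H\<^esub> B"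
      using Uc Bc by (auto simp: RCOSETS_def coset_mult_assoc)
  qed
  ultimately show ?thesis
    using fin by (meson finite_PiE finite_imageD finite_subset)
qed

text \<open>If \<open>r = b h\<close> is the chosen representative of the coset \<open>B h\<close>,
  then \<open>h^-1 u h = r^-1 (b u b^-1) r\<close> with \<open>b u b^-1\<close> again in
  \<open>U\<close>. A conjugate of \<open>u\<close> is thus determined by a coset and an element of
  \<open>U\<close>, both ranging over finite sets.\<close>

lemma (in group) finite_conjugates_finite_index:
  assumes B: "subgroup B G" and fin: "finite (rcosets B)"
    and U: "U \<lhd> G\<lparr>carrier := B\<rparr>" and finU: "finite U" and u: "u \<in> U"
  shows "finite ((\<lambda>h. inv h \<otimes> u \<otimes> h) ` carrier G)"
proof -
  have UB: "U \<subseteq> B"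
    using normal_imp_subgroup[OF U] subgroup.subset by force
  have Bc: "B \<subseteq> carrier G" using B by (rule subgroup.subset)
  define r where "r c = (SOME x. x \<in> c)" for c :: "'a set"
  have "inv h \<otimes> u \<otimes> h \<in> (\<lambda>(c, x). inv (r c) \<otimes> x \<otimes> r c) ` ((rcosets B) \<times> U)"
    if h: "h \<in> carrier G" for h
  proof -
    let ?c = "B #> h"
    have "r ?c \<in> ?c"
      unfolding r_def using rcos_self[OF h B] by (rule someI)
    then obtain b where b: "b \<in> B" "r ?c = b \<otimes> h"
      by (auto simp: r_coset_def)
    have car: "b \<in> carrier G" "u \<in> carrier G" using b u UB Bc by auto
    have "b \<otimes> u \<otimes> inv b \<in> U"
      using normal.inv_op_closed2[OF U, of b u] b(1) u B
      by (simp add: m_inv_consistent)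
    moreover have "inv b \<otimes> (b \<otimes> x) = x" if "x \<in> carrier G" for x
      using car that by (simp add: m_assoc[symmetric])
    then have "inv h \<otimes> u \<otimes> h = inv (r ?c) \<otimes> (b \<otimes> u \<otimes> inv b) \<otimes> r ?c"
      unfolding b(2) using car h by (simp add: inv_mult_group m_assoc)
    moreover have "?c \<in> rcosets B" using h Bc by (simp add: rcosetsI)
    ultimately show ?thesis by (intro image_eqI[of _ _ "(?c, b \<otimes> u \<otimes> inv b)"]) auto
  qed
  then have "(\<lambda>h. inv h \<otimes> u \<otimes> h) ` carrier G \<subseteq>
      (\<lambda>(c, x). inv (r c) \<otimes> x \<otimes> r c) ` ((rcosets B) \<times> U)"
    by blast
  then show ?thesis
    using fin finU by (meson finite_SigmaI finite_imageI finite_subset)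
qed

section \<open>BN-pairs in which \<open>N\<close> normalises \<open>B\<close>\<close>

lemma BN_pair_normalised_imp_trivial:
  assumes bn: "BN_pair H B N"
    and norm: "\<And>n b. n \<in> N \<Longrightarrow> b \<in> B \<Longrightarrow> n \<otimes>\<^bsub>H\<^esub> b \<otimes>\<^bsub>H\<^esub> inv\<^bsub>H\<^esub> n \<in> B"
  shows "B = carrier H"
proof -
  let ?W = "weyl_group H B N"
  interpret group H using bn by (simp add: BN_pair_def)
  interpret W: group ?W using bn by (rule BN_pair_group_weyl_group)
  have B: "subgroup B H" and N: "subgroup N H"
    and gen: "generate H (B \<union> N) = carrier H"
    using bn by (simp_all add: BN_pair_def)
  obtain S where S: "S \<subseteq> carrier ?W" "generate ?W S = carrier ?W"
    and BN2: "\<forall>s\<in>S. \<not> s <#>\<^bsub>H\<^esub> B <#>\<^bsub>H\<^esub> inv\<^bsub>?W\<^esub> s \<subseteq> B"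
    using bn unfolding BN_pair_def Let_def by blast
  \<comment> \<open>For \<open>x\<close> in \<open>s\<close> and \<open>y\<close> in its inverse,
    \<open>x y\<close> lies in \<open>B \<inter> N\<close>, so
    \<open>x b y = (x b x^-1) (x y)\<close> is a product of two elements of
    \<open>B\<close>.\<close>
  have "s <#>\<^bsub>H\<^esub> B <#>\<^bsub>H\<^esub> inv\<^bsub>?W\<^esub> s \<subseteq> B" if s: "s \<in> carrier ?W" for s
  proof
    fix z assume "z \<in> s <#>\<^bsub>H\<^esub> B <#>\<^bsub>H\<^esub> inv\<^bsub>?W\<^esub> s"
    then obtain x b y where xby: "x \<in> s" "b \<in> B" "y \<in> inv\<^bsub>?W\<^esub> s"
      and z: "z = x \<otimes>\<^bsub>H\<^esub> b \<otimes>\<^bsub>H\<^esub> y"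
      by (auto simp: set_mult_def)
    have xy: "x \<in> N" "y \<in> N"
      using xby s W.inv_closed[OF s] BN_pair_weyl_group_subset[OF bn] by blast+
    then have car: "x \<in> carrier H" "y \<in> carrier H" "b \<in> carrier H"
      using subgroup.mem_carrier[OF N] subgroup.mem_carrier[OF B] xby by auto
    have "x \<otimes>\<^bsub>H\<^esub> y \<in> s <#>\<^bsub>H\<^esub> inv\<^bsub>?W\<^esub> s"
      using xby by (auto simp: set_mult_def)
    then have "x \<otimes>\<^bsub>H\<^esub> y \<in> B"
      using W.r_inv[OF s] by simp
    moreover have "x \<otimes>\<^bsub>H\<^esub> b \<otimes>\<^bsub>H\<^esub> inv\<^bsub>H\<^esub> x \<in> B"
      using norm xy xby by simp
    moreover have "z = (x \<otimes>\<^bsub>H\<^esub> b \<otimes>\<^bsub>H\<^esub> inv\<^bsub>H\<^esub> x) \<otimes>\<^bsub>H\<^esub> (x \<otimes>\<^bsub>H\<^esub> y)"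
      unfolding z using car by (simp add: m_assoc inv_solve_left)
    ultimately show "z \<in> B"
      using subgroup.m_closed[OF B] by simp
  qed
  \<comment> \<open>Every element of the Weyl group would violate (BN2) as a generator. The empty
    set therefore generates it, the only coset is \<open>B \<inter> N\<close>, and \<open>N\<close>
    falls into \<open>B\<close>.\<close>
  then have "S = {}" using S(1) BN2 by blast
  then have W1: "carrier ?W = {B \<inter> N}"
    using S(2) W.generate_empty by simp
  have "N \<subseteq> B"
  proof
    fix n assume n: "n \<in> N"
    then have "(B \<inter> N) #>\<^bsub>H\<^esub> n = B \<inter> N"
      using r_coset_in_carrier_weyl_group[OF n, of H B] W1 by simp
    moreover have "n \<in> (B \<inter> N) #>\<^bsub>H\<^esub> n"
      using n rcos_self[OF _ subgroups_Inter_pair[OF B N]] subgroup.mem_carrier[OF N] by blast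
    ultimately show "n \<in> B" by simp
  qed
  then show ?thesis
    using gen generate_subgroup_incl[OF _ B, of "B \<union> N"] subgroup.subset[OF B] by auto
qed

text \<open>Write \<open>b = u t\<close>. Conjugation by \<open>n\<close> in \<open>N\<close> fixes
  the central factor \<open>u\<close> and keeps \<open>t\<close> in \<open>B \<inter> N\<close>,
  which is normal in \<open>N\<close>; so \<open>N\<close> normalises \<open>B\<close>.\<close>

lemma BN_pair_central_complement_imp_trivial:
  assumes bn: "BN_pair H B N" and U: "U <#>\<^bsub>H\<^esub> (B \<inter> N) = B" "U \<subseteq> carrier H"
    and central: "\<And>u h. u \<in> U \<Longrightarrow> h \<in> carrier H \<Longrightarrow> u \<otimes>\<^bsub>H\<^esub> h = h \<otimes>\<^bsub>H\<^esub> u"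
  shows "B = carrier H"
proof (rule BN_pair_normalised_imp_trivial[OF bn])
  fix n b assume n: "n \<in> N" and b: "b \<in> B"
  interpret group H using bn by (simp add: BN_pair_def)
  have N: "subgroup N H" and T: "(B \<inter> N) \<lhd> H\<lparr>carrier := N\<rparr>"
    using bn by (simp_all add: BN_pair_def)
  obtain u t where ut: "u \<in> U" "t \<in> B \<inter> N" "b = u \<otimes>\<^bsub>H\<^esub> t"
    using equalityD2[OF U(1), THEN subsetD, OF b] unfolding set_mult_def by blast
  have car: "n \<in> carrier H" "u \<in> carrier H" "t \<in> carrier H"
    using n ut U(2) subgroup.mem_carrier[OF N] by auto
  have "n \<otimes>\<^bsub>H\<^esub> t \<otimes>\<^bsub>H\<^esub> inv\<^bsub>H\<^esub> n \<in> B \<inter> N"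
    using normal.inv_op_closed2[OF T, of n t] n ut(2) N by (simp add: m_inv_consistent)
  moreover have "n \<otimes>\<^bsub>H\<^esub> b \<otimes>\<^bsub>H\<^esub> inv\<^bsub>H\<^esub> n = u \<otimes>\<^bsub>H\<^esub> (n \<otimes>\<^bsub>H\<^esub> t \<otimes>\<^bsub>H\<^esub> inv\<^bsub>H\<^esub> n)"
    using car central[OF ut(1) car(1)] ut(3) by (simp add: m_assoc[symmetric])
  ultimately have "n \<otimes>\<^bsub>H\<^esub> b \<otimes>\<^bsub>H\<^esub> inv\<^bsub>H\<^esub> n \<in> U <#>\<^bsub>H\<^esub> (B \<inter> N)"
    using ut(1) unfolding set_mult_def by blast
  then show "n \<otimes>\<^bsub>H\<^esub> b \<otimes>\<^bsub>H\<^esub> inv\<^bsub>H\<^esub> n \<in> B"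
    using U(1) by simp
qed

section \<open>Zariski-closed transporters and connectedness\<close>

lemma sum_regular_functions:
  assumes "finite I" "\<And>i. i \<in> I \<Longrightarrow> p i \<in> regular_functions"
  shows "(\<lambda>g. \<Sum>i\<in>I. p i g) \<in> regular_functions"
  using assms
  by (induction I rule: finite_induct)
    (auto intro: regular_functions.const regular_functions.add)

text \<open>Writing conjugacy as \<open>u ** g = g ** v\<close> instead of with the inverse of
  \<open>g\<close> makes the conditions linear in the entries of \<open>g\<close>. The case
  \<open>v = u\<close> is the centraliser.\<close>

lemma closedin_zariski_transporter:
  fixes u v :: "'a::field ^ 'n ^ 'n"
  shows "closedin zariski {g \<in> carrier GL. u ** g = g ** v}"
proof -
  \<comment> \<open>One function per entry of \<open>u ** g - g ** v\<close>. The minus sign is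
    moved into the constants because \<open>regular_functions\<close> is generated by sums and
    products.\<close>
  define p where "p = (\<lambda>(i, j) g. (\<Sum>k\<in>UNIV. u $ i $ k * g $ k $ j)
    + (\<Sum>k\<in>UNIV. g $ i $ k * - v $ k $ j))"
  have "range p \<subseteq> regular_functions"
    unfolding p_def
    by (clarify, intro regular_functions.add sum_regular_functions regular_functions.mult
        regular_functions.const regular_functions.entry finite)
  moreover have "(u ** g = g ** v) \<longleftrightarrow> (\<forall>q\<in>range p. q g = 0)" for g
    by (auto simp: p_def matrix_matrix_mult_def vec_eq_iff sum_negf)
  ultimately show ?thesis
    unfolding closedin_zariski by (intro exI[of _ "range p"]) auto
qed

text \<open>The transporters from \<open>u\<close> to the members of \<open>V\<close> are finitely
  many disjoint closed sets. They cover \<open>H\<close>, hence its closure \<open>G\<close>, and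
  connectedness puts \<open>G\<close> inside the one containing \<open>mat 1\<close>, the
  centraliser of \<open>u\<close>.\<close>

lemma connectedin_finite_conjugates_imp_central:
  fixes G H :: "('a::field ^ 'n ^ 'n) set"
  assumes conn: "connectedin zariski G" and one: "mat 1 \<in> G"
    and dense: "(subtopology zariski G) closure_of H = G" and HG: "H \<subseteq> G"
    and fin: "finite V" and u: "u \<in> V"
    and conj: "\<And>h. h \<in> H \<Longrightarrow> \<exists>v\<in>V. u ** h = h ** v"
    and g: "g \<in> G"
  shows "u ** g = g ** u"
proof (rule ccontr)
  assume ne: "u ** g \<noteq> g ** u"
  define F where "F v = {g \<in> carrier GL. u ** g = g ** v}" for v
  have GGL: "G \<subseteq> carrier GL"
    using connectedin_subset_topspace[OF conn] by (simp add: topspace_zariski)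
  have F: "closedin zariski (F v)" for v
    unfolding F_def by (rule closedin_zariski_transporter)
  have closed: "closedin zariski (\<Union>v\<in>A. F v)" if "A \<subseteq> V" for A
    using fin that F by (intro closedin_Union) (auto intro: finite_subset)
  \<comment> \<open>A relatively closed set containing \<open>H\<close> contains its closure, so the
    covering passes from \<open>H\<close> to \<open>G\<close>.\<close>
  have "closedin (subtopology zariski G) (G \<inter> (\<Union>v\<in>V. F v))"
    using closed[of V] by (auto simp: closedin_subtopology)
  moreover have "H \<subseteq> G \<inter> (\<Union>v\<in>V. F v)"
    using conj HG GGL by (fastforce simp: F_def)
  ultimately have cover: "G \<subseteq> (\<Union>v\<in>V. F v)"
    using closure_of_minimal dense by blast
  \<comment> \<open>An invertible \<open>h\<close> determines \<open>v\<close> as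
    \<open>h^-1 u h\<close>, so distinct transporters are disjoint.\<close>
  have inj: "v = w" if "h \<in> F v" "h \<in> F w" for h v w
  proof -
    have eq: "h ** v = h ** w" and "invertible h"
      using that by (auto simp: F_def GL_def)
    then obtain k where k: "k ** h = mat 1" unfolding invertible_def by blast
    have "v = k ** h ** v" by (simp add: k)
    also have "\<dots> = k ** h ** w" by (simp add: matrix_mul_assoc[symmetric] eq)
    finally show ?thesis by (simp add: k)
  qed
  \<comment> \<open>A separation of \<open>G\<close> into two closed pieces: the identity witnesses
    that the first is nonempty, and the supposed non-commuting \<open>g\<close> does so for the
    second.\<close>
  have 1: "mat 1 \<in> F u \<inter> G"
    using one GGL by (auto simp: F_def)
  have 2: "g \<in> (\<Union>v\<in>V-{u}. F v) \<inter> G"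
    using g ne cover by (auto simp: F_def)
  have 3: "G \<subseteq> F u \<union> (\<Union>v\<in>V-{u}. F v)"
    using cover by blast
  have 4: "F u \<inter> (\<Union>v\<in>V-{u}. F v) \<inter> G = {}"
    using inj by blast
  show False
    using conn F[of u] closed[of "V - {u}"] 1 2 3 4
    unfolding connectedin_closedin by blast
qed

theorem theorem1p1:
  fixes G H B N :: "('a::alg_closed_field ^ 'n ^ 'n) set"
  assumes "reductive_group G"
    and "subgroup H (GL\<lparr>carrier := G\<rparr>)"
    and "(subtopology zariski G) closure_of H = G"
    and "split_BN_pair (GL\<lparr>carrier := H\<rparr>) B N"
    and "virtually_trivial_BN_pair (GL\<lparr>carrier := H\<rparr>) B N"
  shows "trivial_BN_pair (GL\<lparr>carrier := H\<rparr>) B N"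
proof -
  let ?H = "GL\<lparr>carrier := H\<rparr>"
  have bn: "BN_pair ?H B N" and fin: "finite (rcosets\<^bsub>?H\<^esub> B)"
    using assms(5) by (simp_all add: virtually_trivial_BN_pair_def)
  have sat: "saturated_BN_pair ?H B N"
    using assms(4) by (simp add: split_BN_pair_def)
  obtain U where U: "U \<lhd> ?H\<lparr>carrier := B\<rparr>" "U <#>\<^bsub>?H\<^esub> (B \<inter> N) = B"
      "U \<inter> (B \<inter> N) = {\<one>\<^bsub>?H\<^esub>}"
    using assms(4) unfolding split_BN_pair_def by blast
  interpret H: group ?H using bn by (simp add: BN_pair_def)
  have B: "subgroup B ?H" using bn by (simp add: BN_pair_def)
  have UH: "subgroup U ?H"
    using H.incl_subgroup[OF B normal_imp_subgroup[OF U(1)]] .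
  have finU: "finite U"
    using saturated_BN_pair_finite_complement[OF sat fin UH U(3)] .
  have conn: "connectedin zariski G" and G: "subgroup G GL"
    using assms(1) by (simp_all add: reductive_group_def algebraic_group_def)
  have HG: "H \<subseteq> G"
    using subgroup.subset[OF assms(2)] by simp
  have one: "mat 1 \<in> G"
    using subgroup.one_closed[OF G] by (simp add: GL_def)
  \<comment> \<open>The finite set \<open>V\<close> is taken to be the set of conjugates of
    \<open>u\<close> under \<open>H\<close>; it contains \<open>u\<close> as the conjugate by the
    identity.\<close>
  have "u ** g = g ** u" if u: "u \<in> U" and g: "g \<in> H" for u g
  proof (rule connectedin_finite_conjugates_imp_central[OF conn one assms(3) HG])
    have uH: "u \<in> H" using subgroup.mem_carrier[OF UH u] by simp
    let ?conj = "\<lambda>h. inv\<^bsub>?H\<^esub> h \<otimes>\<^bsub>?H\<^esub> u \<otimes>\<^bsub>?H\<^esub> h"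
    show "finite (?conj ` carrier ?H)"
      using H.finite_conjugates_finite_index[OF B fin U(1) finU u] .
    have "u = ?conj \<one>\<^bsub>?H\<^esub>"
      using uH H.inv_one H.l_one H.r_one by auto
    then show "u \<in> ?conj ` carrier ?H"
      using H.one_closed by blast
    show "\<exists>v\<in>?conj ` carrier ?H. u ** h = h ** v" if h: "h \<in> H" for h
    proof
      have car: "h \<in> carrier ?H" "u \<in> carrier ?H" using h uH by simp_all
      \<comment> \<open>The cancellation is done with the abstract group laws of \<open>?H\<close>;
        only afterwards is its product unfolded to \<open>**\<close>.\<close>
      have "h \<otimes>\<^bsub>?H\<^esub> ?conj h = (h \<otimes>\<^bsub>?H\<^esub> inv\<^bsub>?H\<^esub> h) \<otimes>\<^bsub>?H\<^esub> u \<otimes>\<^bsub>?H\<^esub> h"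
        using car H.m_assoc H.inv_closed H.m_closed by presburger
      also have "\<dots> = u \<otimes>\<^bsub>?H\<^esub> h"
        using car H.r_inv H.l_one by presburger
      finally have "h \<otimes>\<^bsub>?H\<^esub> ?conj h = u \<otimes>\<^bsub>?H\<^esub> h" .
      then show "u ** h = h ** ?conj h" by (simp add: GL_def)
      show "?conj h \<in> ?conj ` carrier ?H" using h by simp
    qed
    show "g \<in> G" using g HG by blast
  qed
  then have "B = carrier ?H"
    using subgroup.subset[OF UH]
    by (intro BN_pair_central_complement_imp_trivial[OF bn U(2)]) (auto simp: GL_def)
  then show ?thesis
    using bn by (simp add: trivial_BN_pair_def)
qed

end
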